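(* Let $\Sigma_f$ be a rotational Ricci surface in $\mathbb{R}^3$, where $f:I\to\mathbb{R}$ is a positive smooth function on an open interval $I\subseteq\mathbb{R}$ defined implicitly by $$af(s)-c\log\left(-af(s)-c\right)=a^2s+d$$ for some $a,c,d\in\mathbb{R}$ with $a\neq0$ and $c\neq0$ such that $af(s)+c<0$ for each $s\in I$. Suppose that the Gaussian curvature $K$ of $\Sigma_f$ does not vanish and set $$s_0=-\frac{c}{a(1+a)}-\frac{c}{a^2}\log\left(-\frac{c}{1+a}\right)-\frac{d}{a^2}$$ when this number is well-defined. Then $f$ is a strictly decreasing diffeomorphism on $I$ (onto its image), and one of the following holds. 1. If $K<0$, then $a\in(-\infty,0)$, $c\in(0,+\infty)$, $f$ is asymptotic to $-\frac ca$, and - either $I\subseteq\mathbb{R}$ and $f(I)\subseteq\left(-\frac ca,+\infty\right)$ for $-1\le a<0$; - or $I\subseteq(s_0,+\infty)$ and $f(I)\subseteq\left(-\frac ca,-\frac{c}{1+a}\right)$ for $a<-1$. 2. If $K>0$, then $a\in(-1,0)\cup(0,+\infty)$, $c\in(-\infty,0)$ and - either $I\subseteq(-\infty,s_0)$ and $f(I)\subseteq\left(-\frac{c}{1+a},-\frac ca\right)$ for $a>0$; - or $I\subseteq(-\infty,s_0)$ and $f(I)\subseteq\left(-\frac{c}{1+a},+\infty\right)$ for $-1<a<0$.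
   Context: Rotational surfaces: let $I\subseteq\mathbb{R}$ be an open interval, and let $f,g:I\to\mathbb{R}$ be smooth with $f>0$, $(f')^2+(g')^2=1$ and $g'\ge 0$. The rotational surface $\Sigma_f\subset\mathbb{R}^3$ is the surface parametrised by $X(s,\theta)=(f(s)\cos\theta,f(s)\sin\theta,g(s))$; its profile curve is $\alpha(s)=(f(s),0,g(s))$, parametrised by arc length. In particular $|f'|\le 1$, and, up to a vertical isometry of $\mathbb{R}^3$, $g(s)=\int_{\sigma}^s\sqrt{1-f'(\zeta)^2}\,d\zeta$ with $\sigma\in I$, so $\Sigma_f$ is determined by $f$. The induced metric is $ds^2+f(s)^2d\theta^2$ and the Gaussian curvature is $K=-f''/f$. A rotational Ricci surface is a rotational surface $\Sigma_f$ whose Gaussian curvature satisfies the Ricci condition $K\Delta K-\|\nabla K\|^2-4K^3=0$, equivalently $KK''-(K')^2-4K^3+\frac{f'}{f}KK'=0$ with $K=-f''/f$. "$f$ is asymptotic to $-\frac ca$" means that, when $f$ is taken on its maximal interval of definition (which is then unbounded above), $f(s)\to-\frac ca$ as $s\to+\infty$. *)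

theory Defs
  imports "HOL-Analysis.Analysis"
begin

text \<open>Smoothness (all derivatives exist) is used on open sets only, where \<^const>\<open>deriv\<close>
  does not depend on the values of the function outside the set.\<close>

definition smooth_on :: "real set \<Rightarrow> (real \<Rightarrow> real) \<Rightarrow> bool" where
  "smooth_on S f \<longleftrightarrow> (\<forall>n. \<forall>x\<in>S. ((deriv ^^ n) f) differentiable (at x))"

definition diffeomorphism_onto_image :: "real set \<Rightarrow> (real \<Rightarrow> real) \<Rightarrow> bool" where
  "diffeomorphism_onto_image S f \<longleftrightarrow>
     open S \<and> open (f ` S) \<and> inj_on f S \<and> smooth_on S f \<and> smooth_on (f ` S) (the_inv_into S f)"

definition pd1 :: "(real \<Rightarrow> real \<Rightarrow> 'a::real_normed_vector) \<Rightarrow> real \<Rightarrow> real \<Rightarrow> 'a" where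
  "pd1 h u v = vector_derivative (\<lambda>t. h t v) (at u)"

definition pd2 :: "(real \<Rightarrow> real \<Rightarrow> 'a::real_normed_vector) \<Rightarrow> real \<Rightarrow> real \<Rightarrow> 'a" where
  "pd2 h u v = vector_derivative (\<lambda>t. h u t) (at v)"

text \<open>A surface patch is given by a parametrisation \<open>X u v\<close> in \<open>\<real>\<^sup>3\<close>; \<open>EE, FF, GG\<close> and
  \<open>LL, MM, NN\<close> are the coefficients of its first and second fundamental forms.\<close>

type_synonym patch = "real \<Rightarrow> real \<Rightarrow> real ^ 3"

definition EE :: "patch \<Rightarrow> real \<Rightarrow> real \<Rightarrow> real" where
  "EE X u v = pd1 X u v \<bullet> pd1 X u v"

definition FF :: "patch \<Rightarrow> real \<Rightarrow> real \<Rightarrow> real" where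
  "FF X u v = pd1 X u v \<bullet> pd2 X u v"

definition GG :: "patch \<Rightarrow> real \<Rightarrow> real \<Rightarrow> real" where
  "GG X u v = pd2 X u v \<bullet> pd2 X u v"

definition area_density :: "patch \<Rightarrow> real \<Rightarrow> real \<Rightarrow> real" where
  "area_density X u v = sqrt (EE X u v * GG X u v - (FF X u v)\<^sup>2)"

definition unit_normal :: "patch \<Rightarrow> real \<Rightarrow> real \<Rightarrow> real ^ 3" where
  "unit_normal X u v =
     (1 / norm (cross3 (pd1 X u v) (pd2 X u v))) *\<^sub>R cross3 (pd1 X u v) (pd2 X u v)"

definition LL :: "patch \<Rightarrow> real \<Rightarrow> real \<Rightarrow> real" where
  "LL X u v = pd1 (pd1 X) u v \<bullet> unit_normal X u v"

definition MM :: "patch \<Rightarrow> real \<Rightarrow> real \<Rightarrow> real" where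
  "MM X u v = pd2 (pd1 X) u v \<bullet> unit_normal X u v"

definition NN :: "patch \<Rightarrow> real \<Rightarrow> real \<Rightarrow> real" where
  "NN X u v = pd2 (pd2 X) u v \<bullet> unit_normal X u v"

definition gaussian_curvature :: "patch \<Rightarrow> real \<Rightarrow> real \<Rightarrow> real" where
  "gaussian_curvature X u v =
     (LL X u v * NN X u v - (MM X u v)\<^sup>2) / (EE X u v * GG X u v - (FF X u v)\<^sup>2)"

text \<open>Squared norm of the gradient and Laplace--Beltrami operator of the induced metric, for a
  function \<open>h\<close> written in the coordinates of the patch: \<open>g\<^sup>i\<^sup>j h\<^sub>i h\<^sub>j\<close> and
  \<open>(1 / W) \<partial>\<^sub>i (W g\<^sup>i\<^sup>j h\<^sub>j)\<close> with \<open>W\<close> the area density. There is no minus sign in the Laplacian.\<close>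

definition grad_norm_sq :: "patch \<Rightarrow> (real \<Rightarrow> real \<Rightarrow> real) \<Rightarrow> real \<Rightarrow> real \<Rightarrow> real" where
  "grad_norm_sq X h u v =
     (GG X u v * (pd1 h u v)\<^sup>2 - 2 * FF X u v * pd1 h u v * pd2 h u v + EE X u v * (pd2 h u v)\<^sup>2)
       / (EE X u v * GG X u v - (FF X u v)\<^sup>2)"

definition laplacian :: "patch \<Rightarrow> (real \<Rightarrow> real \<Rightarrow> real) \<Rightarrow> real \<Rightarrow> real \<Rightarrow> real" where
  "laplacian X h u v =
     (pd1 (\<lambda>u v. (GG X u v * pd1 h u v - FF X u v * pd2 h u v) / area_density X u v) u v
    + pd2 (\<lambda>u v. (EE X u v * pd2 h u v - FF X u v * pd1 h u v) / area_density X u v) u v)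
       / area_density X u v"

definition ricci_condition :: "patch \<Rightarrow> real \<Rightarrow> real \<Rightarrow> bool" where
  "ricci_condition X u v \<longleftrightarrow>
     (let K = gaussian_curvature X
      in K u v * laplacian X K u v - grad_norm_sq X K u v - 4 * (K u v) ^ 3 = 0)"

definition rotational_patch :: "(real \<Rightarrow> real) \<Rightarrow> (real \<Rightarrow> real) \<Rightarrow> patch" where
  "rotational_patch f g s \<theta> = vector [f s * cos \<theta>, f s * sin \<theta>, g s]"

definition rotational_surface :: "real set \<Rightarrow> (real \<Rightarrow> real) \<Rightarrow> (real \<Rightarrow> real) \<Rightarrow> bool" where
  "rotational_surface I f g \<longleftrightarrow>
     open I \<and> is_interval I \<and> I \<noteq> {} \<and> smooth_on I f \<and> smooth_on I g \<and>
     (\<forall>s\<in>I. f s > 0 \<and> (deriv f s)\<^sup>2 + (deriv g s)\<^sup>2 = 1 \<and> deriv g s \<ge> 0)"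

definition rotational_Ricci_surface :: "real set \<Rightarrow> (real \<Rightarrow> real) \<Rightarrow> (real \<Rightarrow> real) \<Rightarrow> bool" where
  "rotational_Ricci_surface I f g \<longleftrightarrow>
     rotational_surface I f g \<and> (\<forall>s\<in>I. \<forall>\<theta>. ricci_condition (rotational_patch f g) s \<theta>)"

definition implicit_profile :: "real \<Rightarrow> real \<Rightarrow> real \<Rightarrow> real set \<Rightarrow> (real \<Rightarrow> real) \<Rightarrow> bool" where
  "implicit_profile a c d I f \<longleftrightarrow>
     (\<forall>s\<in>I. a * f s + c < 0 \<and> a * f s - c * ln (- a * f s - c) = a\<^sup>2 * s + d)"

text \<open>\<open>P I f\<close> expresses that \<open>f\<close> is an admissible function on \<open>I\<close>; the values of \<open>f\<close> outside \<open>I\<close>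
  are irrelevant. A maximal extension is one which cannot be extended to a larger domain within
  the admissible functions.\<close>

definition maximal_extension ::
  "(real set \<Rightarrow> (real \<Rightarrow> real) \<Rightarrow> bool) \<Rightarrow> real set \<Rightarrow> (real \<Rightarrow> real) \<Rightarrow> real set \<Rightarrow> (real \<Rightarrow> real) \<Rightarrow> bool"
where
  "maximal_extension P I f J F \<longleftrightarrow>
     I \<subseteq> J \<and> (\<forall>s\<in>I. F s = f s) \<and> P J F \<and>
     (\<forall>J' F'. J \<subseteq> J' \<and> (\<forall>s\<in>J. F' s = F s) \<and> P J' F' \<longrightarrow> J' = J)"

definition asymptotic_to ::
  "(real set \<Rightarrow> (real \<Rightarrow> real) \<Rightarrow> bool) \<Rightarrow> real set \<Rightarrow> (real \<Rightarrow> real) \<Rightarrow> real \<Rightarrow> bool"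
where
  "asymptotic_to P I f l \<longleftrightarrow>
     (\<exists>J F. maximal_extension P I f J F) \<and>
     (\<forall>J F. maximal_extension P I f J F \<longrightarrow> \<not> bdd_above J \<and> (F \<longlongrightarrow> l) at_top)"

text \<open>The admissible functions relevant here are those defined by the implicit equation which are
  profile functions of a rotational Ricci surface; in particular \<open>\<bar>deriv f s\<bar> \<le> 1\<close> on the domain.\<close>

definition implicit_Ricci_profile :: "real \<Rightarrow> real \<Rightarrow> real \<Rightarrow> real set \<Rightarrow> (real \<Rightarrow> real) \<Rightarrow> bool" where
  "implicit_Ricci_profile a c d I f \<longleftrightarrow>
     implicit_profile a c d I f \<and> (\<exists>g. rotational_Ricci_surface I f g)"

end

theory Submission
  imports Defs "HOL-Real_Asymp.Real_Asymp"
begin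

text \<open>
  Differentiating the implicit equation gives \<open>f' = a + c / f < 0\<close>, hence \<open>f'' = - c f' / f\<^sup>2\<close> and
  \<open>K = - f'' / f = c f' / f\<^sup>3\<close>, which has the sign of \<open>- c\<close>. As \<open>f''\<close> has no zero, \<open>f'\<close> cannot attain
  its lower bound \<open>- 1\<close>, so \<open>- c < (1 + a) f\<close>. Together with \<open>a f + c < 0\<close> this confines the values
  of \<open>f\<close>, and the domain is confined because the implicit equation reads \<open>\<Phi> (f s) = s\<close> with an
  explicit decreasing function \<open>\<Phi>\<close> and \<open>s\<^sub>0 = \<Phi> (- c / (1 + a))\<close>.

  If \<open>c > 0\<close>, let \<open>D\<close> be the interval of values allowed by the two inequalities. The inverse of
  \<open>\<Phi>\<close> on \<open>D\<close> is itself an admissible profile and extends every other one, so it is the only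
  maximal extension. Since \<open>\<Phi>\<close> tends to infinity at \<open>- c / a\<close>, its domain is unbounded above and
  its limit there is \<open>- c / a\<close>.
\<close>

subsection \<open>Smooth functions of one variable\<close>

text \<open>Smoothness without a formula for higher derivatives: by induction each iterated
  \<open>deriv\<close> agrees on \<open>S\<close> with some member of \<open>C\<close>, and since
  \<open>S\<close> is open this agreement passes to the next derivative.\<close>

lemma smooth_on_derivative_closed:
  assumes "open S" and "h \<in> C"
    and step: "\<And>h. h \<in> C \<Longrightarrow> \<exists>h'\<in>C. \<forall>x\<in>S. (h has_real_derivative h' x) (at x)"
  shows "smooth_on S h"
proof -
  have *: "\<exists>k\<in>C. \<forall>x\<in>S. (deriv ^^ n) h x = k x" for n
  proof (induction n)
    case 0
    then show ?case using \<open>h \<in> C\<close> by auto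
  next
    case (Suc n)
    then obtain k where k: "k \<in> C" "\<forall>x\<in>S. (deriv ^^ n) h x = k x" by blast
    obtain k' where k': "k' \<in> C" "\<forall>x\<in>S. (k has_real_derivative k' x) (at x)"
      using step[OF k(1)] by blast
    have "((deriv ^^ n) h has_real_derivative k' x) (at x)" if "x \<in> S" for x
      using k'(2) k(2) that \<open>open S\<close>
      by (auto intro: has_field_derivative_transform_within_open[of k])
    then show ?case
      using k'(1) by (auto intro!: bexI[of _ k'] DERIV_imp_deriv)
  qed
  show ?thesis
    unfolding smooth_on_def
  proof (intro allI ballI)
    fix n x assume x: "x \<in> S"
    obtain k where k: "k \<in> C" "\<forall>x\<in>S. (deriv ^^ n) h x = k x" using * by blast
    obtain k' where k': "k' \<in> C" "\<forall>x\<in>S. (k has_real_derivative k' x) (at x)"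
      using step[OF k(1)] by blast
    have "((deriv ^^ n) h has_real_derivative k' x) (at x)"
      using k'(2) k(2) x \<open>open S\<close>
      by (auto intro: has_field_derivative_transform_within_open[of k])
    then show "(deriv ^^ n) h differentiable at x"
      using real_differentiable_def by blast
  qed
qed

text \<open>On an open set, equality holds near every point and so is inherited by all iterated
  derivatives. This later transfers smoothness from an explicit formula to
  \<open>the_inv_into\<close>.\<close>

lemma smooth_on_cong:
  assumes "open S" and "smooth_on S h" and "\<And>x. x \<in> S \<Longrightarrow> h x = k x"
  shows "smooth_on S k"
proof -
  have eq: "\<forall>x\<in>S. (deriv ^^ n) h x = (deriv ^^ n) k x" for n
  proof (induction n)
    case (Suc n)
    then have "\<forall>\<^sub>F y in nhds x. (deriv ^^ n) h y = (deriv ^^ n) k y" if "x \<in> S" for x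
      using \<open>open S\<close> that eventually_nhds by blast
    then show ?case by (auto intro: deriv_cong_ev)
  qed (use assms in auto)
  show ?thesis
    unfolding smooth_on_def
  proof (intro allI ballI)
    fix n x assume x: "x \<in> S"
    have "(deriv ^^ n) h differentiable at x" using assms(2) x by (simp add: smooth_on_def)
    then obtain D where "((deriv ^^ n) h has_real_derivative D) (at x)"
      using real_differentiable_def by blast
    then have "((deriv ^^ n) k has_real_derivative D) (at x)"
      using eq x \<open>open S\<close> by (auto intro: has_field_derivative_transform_within_open)
    then show "(deriv ^^ n) k differentiable at x"
      using real_differentiable_def by blast
  qed
qed

lemma smooth_on_has_derivative:
  assumes "smooth_on S h" and "x \<in> S"
  shows "(h has_real_derivative deriv h x) (at x)"
proof -
  have "(deriv ^^ 0) h differentiable at x"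
    using assms unfolding smooth_on_def by blast
  then show ?thesis by (simp add: DERIV_deriv_iff_real_differentiable)
qed

lemma smooth_on_has_second_derivative:
  assumes "smooth_on S h" and "x \<in> S"
  shows "(deriv h has_real_derivative deriv (deriv h) x) (at x)"
proof -
  have "(deriv ^^ 1) h differentiable at x"
    using assms unfolding smooth_on_def by blast
  then show ?thesis by (simp add: DERIV_deriv_iff_real_differentiable)
qed

text \<open>Integrate from a fixed base point and apply the fundamental theorem on a compact
  subinterval around each point. This supplies the height function of a profile constructed from its
  radius alone.\<close>

lemma antiderivative_on_open_interval:
  fixes w :: "real \<Rightarrow> real"
  assumes "open J" "is_interval J" "continuous_on J w"
  obtains W where "\<And>x. x \<in> J \<Longrightarrow> (W has_real_derivative w x) (at x)"
proof (cases "J = {}")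
  case False
  then obtain p where p: "p \<in> J" by blast
  have "((\<lambda>u. LBINT y=p..u. w y) has_real_derivative w x) (at x)" if x: "x \<in> J" for x
  proof -
    define l r where "l = min p x" and "r = max p x"
    have "l \<in> J" "r \<in> J" using p x by (auto simp: l_def r_def min_def max_def)
    with \<open>open J\<close> obtain e e' where e: "e > 0" "ball l e \<subseteq> J" and e': "e' > 0" "ball r e' \<subseteq> J"
      by (meson open_contains_ball)
    \<comment> \<open>Half of each radius stays inside \<open>J\<close> yet goes strictly past both
      \<open>p\<close> and \<open>x\<close>, so the one-sided derivative on \<open>{u..v}\<close> is
      a full derivative at \<open>x\<close>.\<close>
    define u v where "u = l - e/2" and "v = r + e'/2"
    have "u \<in> ball l e" "v \<in> ball r e'"
      using e(1) e'(1) by (auto simp: u_def v_def dist_real_def)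
    then have uv: "u \<in> J" "v \<in> J" using e e' by blast+
    then have sub: "{u..v} \<subseteq> J"
      using \<open>is_interval J\<close> by (meson atLeastAtMost_iff mem_is_interval_1_I subsetI)
    have less: "u < p" "p < v" "u < x" "x < v"
      using \<open>e > 0\<close> \<open>e' > 0\<close> unfolding u_def v_def l_def r_def min_def max_def by auto
    have "((\<lambda>t. LBINT y=p..t. w y) has_vector_derivative w x) (at x within {u..v})"
      using less continuous_on_subset[OF assms(3) sub]
      by (intro interval_integral_FTC2) auto
    then show ?thesis
      using less by (simp add: has_real_derivative_iff_has_vector_derivative at_within_Icc_at)
  qed
  then show ?thesis using that by blast
qed (use that in auto)

subsection \<open>Curvature of rotational surfaces\<close>

lemma vector_3_eq_axis:
  "(vector [x, y, z] :: real ^ 3) = x *\<^sub>R axis 1 1 + y *\<^sub>R axis 2 1 + z *\<^sub>R axis 3 1"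
  by (simp add: vec_eq_iff forall_3 axis_def)

lemma has_vector_derivative_vector_3:
  assumes "(x has_real_derivative x') (at t)" "(y has_real_derivative y') (at t)"
    "(z has_real_derivative z') (at t)"
  shows "((\<lambda>t. vector [x t, y t, z t] :: real ^ 3) has_vector_derivative vector [x', y', z']) (at t)"
proof -
  have *: "((\<lambda>t. h t *\<^sub>R b) has_vector_derivative h' *\<^sub>R b) (at t)"
    if "(h has_real_derivative h') (at t)" for h h' and b :: "real ^ 3"
    using has_vector_derivative_scaleR[OF that has_vector_derivative_const[of b]] by simp
  then show ?thesis
    unfolding vector_3_eq_axis by (intro has_vector_derivative_add * assms)
qed

lemma inner_vector_3:
  "(vector [x, y, z] :: real ^ 3) \<bullet> vector [x', y', z'] = x * x' + y * y' + z * z'"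
  by (simp add: inner_vec_def sum_3)

lemma sin_cos_collect: "x * cos \<theta> * (y * cos \<theta>) + x * sin \<theta> * (y * sin \<theta>) = x * (y::real)"
proof -
  have "x * cos \<theta> * (y * cos \<theta>) + x * sin \<theta> * (y * sin \<theta>) = x * y * ((sin \<theta>)\<^sup>2 + (cos \<theta>)\<^sup>2)"
    by algebra
  then show ?thesis by simp
qed

text \<open>The formulas for first partial derivatives and for the curvature hold only over
  \<open>I\<close>; openness allows substituting them before differentiating again.\<close>

lemma vector_derivative_cong_open:
  assumes "open S" "x \<in> S" "\<And>y. y \<in> S \<Longrightarrow> h y = k y" and "(k has_vector_derivative D) (at x)"
  shows "vector_derivative h (at x) = D"
  by (rule vector_derivative_at,
      rule has_vector_derivative_transform_within_open[OF assms(4,1,2)], simp add: assms(3))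

locale rotational =
  fixes I :: "real set" and f g :: "real \<Rightarrow> real"
  assumes surf: "rotational_surface I f g"
begin

abbreviation X where "X \<equiv> rotational_patch f g"

lemma open_I: "open I" and interval_I: "is_interval I"
  using surf by (auto simp: rotational_surface_def)

lemma f_pos: "s \<in> I \<Longrightarrow> f s > 0"
  and unit_speed: "s \<in> I \<Longrightarrow> (deriv f s)\<^sup>2 + (deriv g s)\<^sup>2 = 1"
  using surf by (auto simp: rotational_surface_def)

lemma DERIV_profile:
  assumes "s \<in> I"
  shows "(f has_real_derivative deriv f s) (at s)" "(g has_real_derivative deriv g s) (at s)"
    "(deriv f has_real_derivative deriv (deriv f) s) (at s)"
    "(deriv g has_real_derivative deriv (deriv g) s) (at s)"
proof -
  have "smooth_on I f" "smooth_on I g" using surf by (auto simp: rotational_surface_def)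
  then show "(f has_real_derivative deriv f s) (at s)" "(g has_real_derivative deriv g s) (at s)"
    "(deriv f has_real_derivative deriv (deriv f) s) (at s)"
    "(deriv g has_real_derivative deriv (deriv g) s) (at s)"
    by (simp_all add: assms smooth_on_has_derivative smooth_on_has_second_derivative)
qed

lemma unit_speed_deriv:
  assumes "s \<in> I"
  shows "deriv f s * deriv (deriv f) s + deriv g s * deriv (deriv g) s = 0"
proof -
  have "((\<lambda>t. (deriv f t)\<^sup>2 + (deriv g t)\<^sup>2) has_real_derivative
      2 * deriv f s * deriv (deriv f) s + 2 * deriv g s * deriv (deriv g) s) (at s)"
    by (auto intro!: derivative_eq_intros DERIV_profile(3,4)[OF assms])
  moreover have "((\<lambda>t. (deriv f t)\<^sup>2 + (deriv g t)\<^sup>2) has_real_derivative 0) (at s)"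
    by (rule has_field_derivative_transform_within_open[OF DERIV_const open_I assms])
      (simp add: unit_speed)
  ultimately show ?thesis by (auto dest: DERIV_unique)
qed

lemma pd1_X: "s \<in> I \<Longrightarrow> pd1 X s \<theta> = vector [deriv f s * cos \<theta>, deriv f s * sin \<theta>, deriv g s]"
  unfolding pd1_def rotational_patch_def
  by (rule vector_derivative_at, rule has_vector_derivative_vector_3)
    (auto intro!: derivative_eq_intros DERIV_profile(1,2))

lemma pd2_X: "pd2 X s \<theta> = vector [- f s * sin \<theta>, f s * cos \<theta>, 0]"
  unfolding pd2_def rotational_patch_def
  by (rule vector_derivative_at, rule has_vector_derivative_vector_3)
    (auto intro!: derivative_eq_intros)

lemma pd1_pd1_X:
  assumes "s \<in> I"
  shows "pd1 (pd1 X) s \<theta> = vector [deriv (deriv f) s * cos \<theta>, deriv (deriv f) s * sin \<theta>, deriv (deriv g) s]"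
  unfolding pd1_def[of "pd1 X"]
proof (rule vector_derivative_cong_open[OF open_I assms])
  show "((\<lambda>t. vector [deriv f t * cos \<theta>, deriv f t * sin \<theta>, deriv g t] :: real ^ 3) has_vector_derivative
      vector [deriv (deriv f) s * cos \<theta>, deriv (deriv f) s * sin \<theta>, deriv (deriv g) s]) (at s)"
    by (rule has_vector_derivative_vector_3)
      (auto intro!: derivative_eq_intros DERIV_profile(3,4)[OF assms])
qed (rule pd1_X)

lemma pd2_pd1_X:
  assumes "s \<in> I"
  shows "pd2 (pd1 X) s \<theta> = vector [- deriv f s * sin \<theta>, deriv f s * cos \<theta>, 0]"
  unfolding pd2_def pd1_X[OF assms]
  by (rule vector_derivative_at, rule has_vector_derivative_vector_3)
    (auto intro!: derivative_eq_intros)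

lemma pd2_pd2_X: "pd2 (pd2 X) s \<theta> = vector [- f s * cos \<theta>, - f s * sin \<theta>, 0]"
  unfolding pd2_def[of "pd2 X"] pd2_X
  by (rule vector_derivative_at, rule has_vector_derivative_vector_3)
    (auto intro!: derivative_eq_intros)

lemma EE_X: "s \<in> I \<Longrightarrow> EE X s \<theta> = 1"
  using unit_speed[of s]
  by (simp add: EE_def pd1_X inner_vector_3 sin_cos_collect power2_eq_square)

lemma FF_X: "s \<in> I \<Longrightarrow> FF X s \<theta> = 0"
  by (simp add: FF_def pd1_X pd2_X inner_vector_3)

lemma GG_X: "GG X s \<theta> = (f s)\<^sup>2"
  using sin_cos_collect[of "f s" \<theta> "f s"]
  by (simp add: GG_def pd2_X inner_vector_3 power2_eq_square)

lemma area_density_X: "s \<in> I \<Longrightarrow> area_density X s \<theta> = f s"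
  using f_pos[of s] by (simp add: area_density_def EE_X FF_X GG_X)

lemma unit_normal_X:
  assumes "s \<in> I"
  shows "unit_normal X s \<theta> = vector [- deriv g s * cos \<theta>, - deriv g s * sin \<theta>, deriv f s]"
proof -
  let ?n = "vector [- deriv g s * cos \<theta>, - deriv g s * sin \<theta>, deriv f s] :: real ^ 3"
  \<comment> \<open>The cross product is \<open>f s\<close> times a unit vector, and
    \<open>f s > 0\<close>, so normalising removes exactly this factor.\<close>
  have "cross3 (pd1 X s \<theta>) (pd2 X s \<theta>) = f s *\<^sub>R ?n"
    using sin_cos_collect[of "f s" \<theta> "deriv f s"]
    by (simp add: pd1_X assms pd2_X cross3_def vec_eq_iff forall_3 algebra_simps)
  moreover have "?n \<bullet> ?n = 1"
    using unit_speed[OF assms] sin_cos_collect[of "deriv g s" \<theta> "deriv g s"]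
    by (simp add: inner_vector_3 power2_eq_square)
  then have "norm ?n = 1" by (simp add: norm_eq_sqrt_inner)
  ultimately show ?thesis
    using f_pos[OF assms] by (simp add: unit_normal_def)
qed

lemma gaussian_curvature_X:
  assumes "s \<in> I"
  shows "gaussian_curvature X s \<theta> = - deriv (deriv f) s / f s"
proof -
  let ?f' = "deriv f s" and ?g' = "deriv g s" and ?f'' = "deriv (deriv f) s" and ?g'' = "deriv (deriv g) s"
  have L: "LL X s \<theta> = ?f' * ?g'' - ?f'' * ?g'"
    using sin_cos_collect[of ?f'' \<theta> ?g']
    by (simp add: LL_def pd1_pd1_X unit_normal_X assms inner_vector_3 mult.commute)
  have M: "MM X s \<theta> = 0"
    by (simp add: MM_def pd2_pd1_X unit_normal_X assms inner_vector_3)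
  have N: "NN X s \<theta> = f s * ?g'"
    using sin_cos_collect[of "f s" \<theta> ?g']
    by (simp add: NN_def pd2_pd2_X unit_normal_X assms inner_vector_3)
  \<comment> \<open>Substituting \<open>?g' * ?g'' = - ?f' * ?f''\<close> turns the left side into
    \<open>- ?f''\<close> times the squared speed, which is 1.\<close>
  have "(?f' * ?g'' - ?f'' * ?g') * ?g' = - ?f''"
    using unit_speed[OF assms] unit_speed_deriv[OF assms] by algebra
  then have "LL X s \<theta> * NN X s \<theta> = - ?f'' * f s"
    by (metis L N mult.assoc mult.commute)
  then show ?thesis
    using f_pos[OF assms] M
    by (simp add: gaussian_curvature_def EE_X FF_X GG_X assms power2_eq_square)
qed

text \<open>The curvature depends on \<open>s\<close> only and the area density is \<open>f\<close>,
  so the Laplacian reduces to \<open>(f k')' / f\<close> and the squared gradient to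
  \<open>k'\<close> squared.\<close>

lemma ricci_condition_X:
  assumes k: "\<And>s. s \<in> I \<Longrightarrow> - deriv (deriv f) s / f s = k s"
    and k': "\<And>s. s \<in> I \<Longrightarrow> (k has_real_derivative k' s) (at s)"
    and k'': "(k' has_real_derivative k'') (at s)" and s: "s \<in> I"
  shows "ricci_condition X s \<theta> \<longleftrightarrow>
    k s * (k'' + deriv f s / f s * k' s) - (k' s)\<^sup>2 - 4 * (k s) ^ 3 = 0"
proof -
  let ?K = "gaussian_curvature X"
  have K: "?K t v = k t" if "t \<in> I" for t v
    using gaussian_curvature_X[OF that] k[OF that] by simp
  have p1: "pd1 ?K t v = k' t" if "t \<in> I" for t v
    unfolding pd1_def
    by (rule vector_derivative_cong_open[OF open_I that, where k = k])
      (use K k'[OF that] in \<open>auto simp: has_real_derivative_iff_has_vector_derivative\<close>)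
  have p2: "pd2 ?K t v = 0" if "t \<in> I" for t v
    using K[OF that] by (simp add: pd2_def vector_derivative_const_at)
  have "pd1 (\<lambda>u v. (GG X u v * pd1 ?K u v - FF X u v * pd2 ?K u v) / area_density X u v) s \<theta>
      = deriv f s * k' s + f s * k''"
    unfolding pd1_def[of "\<lambda>u v. (GG X u v * pd1 ?K u v - FF X u v * pd2 ?K u v) / area_density X u v"]
  proof (rule vector_derivative_cong_open[OF open_I s, where k = "\<lambda>t. f t * k' t"])
    show "(GG X t \<theta> * pd1 ?K t \<theta> - FF X t \<theta> * pd2 ?K t \<theta>) / area_density X t \<theta> = f t * k' t"
      if "t \<in> I" for t
      using f_pos[OF that]
      by (simp add: that FF_X GG_X area_density_X p1 power2_eq_square)
    show "((\<lambda>t. f t * k' t) has_vector_derivative deriv f s * k' s + f s * k'') (at s)"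
      using DERIV_profile(1)[OF s] k''
      by (auto simp flip: has_real_derivative_iff_has_vector_derivative intro!: derivative_eq_intros)
  qed
  moreover have "pd2 (\<lambda>u v. (EE X u v * pd2 ?K u v - FF X u v * pd1 ?K u v) / area_density X u v) s \<theta> = 0"
    by (simp add: pd2_def[of "\<lambda>u v. (EE X u v * pd2 ?K u v - FF X u v * pd1 ?K u v) / area_density X u v"] 
        s FF_X p2 vector_derivative_const_at)
  ultimately have "laplacian X ?K s \<theta> = k'' + deriv f s / f s * k' s"
    using f_pos[OF s]
    by (simp add: laplacian_def area_density_X s field_simps)
  moreover have "grad_norm_sq X ?K s \<theta> = (k' s)\<^sup>2"
    using f_pos[OF s] by (simp add: grad_norm_sq_def EE_X FF_X GG_X s p1 p2)
  ultimately show ?thesis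
    by (simp add: ricci_condition_def Let_def K s)
qed

end

subsection \<open>Profiles given by the implicit equation\<close>

text \<open>The implicit equation is affine in \<open>s\<close>; this is its solution for
  \<open>s\<close> as a function of the value \<open>x = f s\<close>, hence the inverse of any
  profile.\<close>

definition profile_inverse :: "real \<Rightarrow> real \<Rightarrow> real \<Rightarrow> real \<Rightarrow> real" where
  "profile_inverse a c d x = (a * x - c * ln (- a * x - c) - d) / a\<^sup>2"

lemma implicit_profile_iff:
  assumes "a \<noteq> 0"
  shows "implicit_profile a c d I f \<longleftrightarrow> (\<forall>s\<in>I. a * f s + c < 0 \<and> profile_inverse a c d (f s) = s)"
  using assms by (auto simp: implicit_profile_def profile_inverse_def field_simps)

lemma profile_inverse_deriv:
  assumes "a \<noteq> 0" "a * x + c < 0"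
  shows "(profile_inverse a c d has_real_derivative x / (a * x + c)) (at x)"
proof -
  have "a - c * (- a / (- a * x - c)) = a\<^sup>2 * (x / (a * x + c))"
    using assms by (simp add: divide_simps power2_eq_square) algebra
  then have "(a - c * (- a / (- a * x - c))) / a\<^sup>2 = x / (a * x + c)"
    using assms by simp
  moreover have "((\<lambda>x. a * x - c * ln (- a * x - c) - d) has_real_derivative
      a - c * (- a / (- a * x - c))) (at x)"
    using assms by (auto intro!: derivative_eq_intros)
  then have "(profile_inverse a c d has_real_derivative (a - c * (- a / (- a * x - c))) / a\<^sup>2) (at x)"
    unfolding profile_inverse_def by (rule DERIV_cdivide)
  ultimately show ?thesis by simp
qed

text \<open>The derivative \<open>t / (a * t + c)\<close> is negative between \<open>x\<close> and
  \<open>y\<close>, because an affine function that is negative at both ends is negative in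
  between.\<close>

lemma profile_inverse_decreasing:
  assumes "a \<noteq> 0" "0 < x" "x < y" "a * x + c < 0" "a * y + c < 0"
  shows "profile_inverse a c d y < profile_inverse a c d x"
proof (rule DERIV_neg_imp_decreasing[OF \<open>x < y\<close>])
  fix t assume t: "x \<le> t" "t \<le> y"
  have "a * t \<le> max (a * x) (a * y)"
    using t by (cases "a > 0") (auto simp: le_max_iff_disj mult_le_cancel_left)
  then have "a * t + c < 0" using assms by (auto simp: max_def split: if_splits)
  then show "\<exists>D. (profile_inverse a c d has_real_derivative D) (at t) \<and> D < 0"
    using profile_inverse_deriv[OF \<open>a \<noteq> 0\<close>, of t c d] t \<open>0 < x\<close>
    by (intro exI[of _ "t / (a * t + c)"]) (auto simp: divide_pos_neg)
qed

lemma profile_inverse_smooth: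
  assumes "a \<noteq> 0" "open S" and S: "\<And>x. x \<in> S \<Longrightarrow> a * x + c < 0"
  shows "smooth_on S (profile_inverse a c d)"
proof -
  \<comment> \<open>The first derivative is a polynomial in \<open>1 / (a * x + c)\<close>, and such
    polynomials are closed under differentiation.\<close>
  define C where "C = insert (profile_inverse a c d) (range (\<lambda>p x. poly p (1 / (a * x + c))))"
  show ?thesis
  proof (rule smooth_on_derivative_closed[OF \<open>open S\<close>, where C = C])
    show "profile_inverse a c d \<in> C" by (simp add: C_def)
    fix h assume "h \<in> C"
    then consider "h = profile_inverse a c d" | p where "h = (\<lambda>x. poly p (1 / (a * x + c)))"
      by (auto simp: C_def)
    then show "\<exists>h'\<in>C. \<forall>x\<in>S. (h has_real_derivative h' x) (at x)"
    proof cases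
      case 1
      \<comment> \<open>This is the partial fraction form
        \<open>1 / a - (c / a) / (a * x + c)\<close> of \<open>x / (a * x + c)\<close>.\<close>
      define k where "k x = poly [:1 / a, - c / a:] (1 / (a * x + c))" for x
      have "k x = x / (a * x + c)" if "x \<in> S" for x
        using S[OF that] \<open>a \<noteq> 0\<close> by (simp add: k_def divide_simps)
      then have "\<forall>x\<in>S. (h has_real_derivative k x) (at x)"
        using profile_inverse_deriv[OF \<open>a \<noteq> 0\<close> S, of _ d] 1 by simp
      moreover have "k \<in> C" unfolding C_def k_def by blast
      ultimately show ?thesis by blast
    next
      case 2
      define k where "k x = poly (pderiv p * [:0, 0, - a:]) (1 / (a * x + c))" for x
      have "(h has_real_derivative k x) (at x)" if "x \<in> S" for x
      proof -
        have "((\<lambda>x. 1 / (a * x + c)) has_real_derivative - a * (1 / (a * x + c))\<^sup>2) (at x)"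
          using S[OF that]
          by (auto intro!: derivative_eq_intros simp: divide_simps power2_eq_square)
        from DERIV_chain2[OF poly_DERIV this] show ?thesis
          by (simp add: 2 k_def power2_eq_square algebra_simps)
      qed
      moreover have "k \<in> C" unfolding C_def k_def by blast
      ultimately show ?thesis by blast
    qed
  qed
qed

locale implicit_rotational = rotational +
  fixes a c d :: real
  assumes a_nonzero: "a \<noteq> 0" and c_nonzero: "c \<noteq> 0" and implicit: "implicit_profile a c d I f"
begin

lemma af_c_neg: "s \<in> I \<Longrightarrow> a * f s + c < 0"
  and profile_inverse_f: "s \<in> I \<Longrightarrow> profile_inverse a c d (f s) = s"
  using implicit by (auto simp: implicit_profile_iff[OF a_nonzero])

text \<open>Differentiate the identity \<open>profile_inverse a c d (f t) = t\<close>, valid near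
  \<open>s\<close>, by the chain rule.\<close>

lemma deriv_f:
  assumes s: "s \<in> I"
  shows "deriv f s = a + c / f s"
proof -
  have "((\<lambda>t. profile_inverse a c d (f t)) has_real_derivative f s / (a * f s + c) * deriv f s) (at s)"
    by (rule DERIV_chain2[OF profile_inverse_deriv[OF a_nonzero af_c_neg[OF s]] DERIV_profile(1)[OF s]])
  moreover have "((\<lambda>t. profile_inverse a c d (f t)) has_real_derivative 1) (at s)"
    by (rule has_field_derivative_transform_within_open[OF DERIV_ident open_I s])
      (simp add: profile_inverse_f)
  ultimately have "f s / (a * f s + c) * deriv f s = 1" by (rule DERIV_unique)
  then show ?thesis
    using f_pos[OF s] af_c_neg[OF s] by (simp add: field_simps)
qed

lemma DERIV_f: "s \<in> I \<Longrightarrow> (f has_real_derivative a + c / f s) (at s)"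
  using DERIV_profile(1) deriv_f by simp

lemma DERIV_deriv_f:
  assumes s: "s \<in> I"
  shows "(deriv f has_real_derivative - c * (a + c / f s) / (f s)\<^sup>2) (at s)"
proof (rule has_field_derivative_transform_within_open[OF _ open_I s])
  show "((\<lambda>t. a + c / f t) has_real_derivative - c * (a + c / f s) / (f s)\<^sup>2) (at s)"
    using f_pos[OF s] by (auto intro!: derivative_eq_intros DERIV_f[OF s] simp: power2_eq_square)
qed (simp add: deriv_f)

lemma deriv_f_neg:
  assumes "s \<in> I"
  shows "a + c / f s < 0"
proof -
  have "a + c / f s = (a * f s + c) / f s" using f_pos[OF assms] by (simp add: field_simps)
  then show ?thesis using af_c_neg[OF assms] f_pos[OF assms] by (simp add: divide_neg_pos)
qed

text \<open>Where \<open>f' = -1\<close>, the function \<open>f'\<close> would attain its minimum, but \<open>f''\<close> has no zero.\<close>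

lemma deriv_f_gt:
  assumes s: "s \<in> I"
  shows "- 1 < deriv f s"
proof -
  have ge: "- 1 \<le> deriv f t" if "t \<in> I" for t
  proof -
    have "(deriv f t)\<^sup>2 \<le> 1" using unit_speed[OF that] by (metis le_add_same_cancel1 zero_le_power2)
    then show ?thesis by (simp add: abs_square_le_1 abs_le_iff)
  qed
  have "deriv f s \<noteq> - 1"
  proof
    assume eq: "deriv f s = - 1"
    obtain e where e: "e > 0" "ball s e \<subseteq> I" using open_I s open_contains_ball by blast
    have "- c * (a + c / f s) / (f s)\<^sup>2 = 0"
    proof (rule DERIV_local_min[OF DERIV_deriv_f[OF s] \<open>e > 0\<close>], intro allI impI)
      fix t assume "\<bar>s - t\<bar> < e"
      then have "t \<in> I" using e by (auto simp: dist_real_def)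
      then show "deriv f s \<le> deriv f t" using ge eq by simp
    qed
    then show False using c_nonzero deriv_f_neg[OF s] f_pos[OF s] by simp
  qed
  then show ?thesis using ge[OF s] by simp
qed

text \<open>This is \<open>f' > -1\<close> multiplied by \<open>f\<close>; it produces the bound
  \<open>- c / (1 + a)\<close>, as a lower or upper one according to the sign of
  \<open>1 + a\<close>.\<close>

lemma f_lower:
  assumes s: "s \<in> I"
  shows "- c < (1 + a) * f s"
  using deriv_f_gt[OF s] f_pos[OF s] by (simp add: deriv_f[OF s] field_simps)

lemma gaussian_curvature_implicit:
  assumes s: "s \<in> I"
  shows "gaussian_curvature X s \<theta> = c * (a + c / f s) / (f s) ^ 3"
  using f_pos[OF s]
  by (simp add: gaussian_curvature_X[OF s] DERIV_imp_deriv[OF DERIV_deriv_f[OF s]]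
      power2_eq_square power3_eq_cube)

lemma f_decreasing: "strict_antimono_on I f"
proof (rule monotone_onI)
  fix x y assume xy: "x \<in> I" "y \<in> I" "x < y"
  have "\<exists>D. (f has_real_derivative D) (at t) \<and> D < 0" if "x \<le> t" "t \<le> y" for t
  proof -
    have "t \<in> I" using interval_I xy that by (meson mem_is_interval_1_I)
    then show ?thesis using DERIV_f deriv_f_neg by blast
  qed
  with \<open>x < y\<close> show "f x > f y" by (rule DERIV_neg_imp_decreasing)
qed

lemma inj_f: "inj_on f I"
  using profile_inverse_f by (metis inj_onI)

text \<open>The image is open since \<open>f\<close> is continuous and injective on an open set, and
  on it the inverse coincides with the smooth function \<open>profile_inverse\<close>.\<close>

lemma f_diffeomorphism: "diffeomorphism_onto_image I f"
proof -
  have "continuous_on I f"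
    using DERIV_f by (meson DERIV_isCont continuous_at_imp_continuous_on)
  then have op: "open (f ` I)"
    using open_I inj_f by (intro injective_into_1d_imp_open_map_UNIV) auto
  have "smooth_on (f ` I) (the_inv_into I f)"
    by (rule smooth_on_cong[OF op profile_inverse_smooth[OF a_nonzero op, of c d]])
      (auto simp: af_c_neg profile_inverse_f the_inv_into_f_f[OF inj_f])
  then show ?thesis
    using surf open_I inj_f op by (simp add: diffeomorphism_onto_image_def rotational_surface_def)
qed

text \<open>The implicit equation already forces the Ricci condition on a rotational surface. This
  is what makes the constructed maximal profile admissible.\<close>

lemma ricci_condition_implicit:
  assumes s: "s \<in> I"
  shows "ricci_condition X s \<theta>"
proof -
  \<comment> \<open>In terms of \<open>u = 1 / f\<close> everything is polynomial:
    \<open>u' = - u\<^sup>2 (a + c u)\<close> and the curvature is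
    \<open>c u\<^sup>3 (a + c u)\<close>, so the Ricci condition becomes a polynomial
    identity.\<close>
  define u where "u t = 1 / f t" for t
  have du: "(u has_real_derivative - (u t)\<^sup>2 * (a + c * u t)) (at t)" if "t \<in> I" for t
    unfolding u_def
    using f_pos[OF that]
    by (auto intro!: derivative_eq_intros DERIV_f[OF that] simp: power2_eq_square diff_divide_distrib add_divide_distrib)
  define k where "k t = c * (a * u t ^ 3 + c * u t ^ 4)" for t
  define k' where "k' t = - c * (3 * a * u t ^ 4 + 4 * c * u t ^ 5) * (a + c * u t)" for t
  define k'' where "k'' = c * (u s)\<^sup>2 * (a + c * u s) *
      ((12 * a * u s ^ 3 + 20 * c * u s ^ 4) * (a + c * u s) + c * (3 * a * u s ^ 4 + 4 * c * u s ^ 5))"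
  have "- deriv (deriv f) t / f t = k t" if "t \<in> I" for t
    using f_pos[OF that]
    by (simp add: DERIV_imp_deriv[OF DERIV_deriv_f[OF that]] k_def u_def field_simps eval_nat_numeral)
  moreover have "(k has_real_derivative k' t) (at t)" if "t \<in> I" for t
    unfolding k_def k'_def
    by (auto intro!: derivative_eq_intros du[OF that]) algebra
  moreover have "(k' has_real_derivative k'') (at s)"
    unfolding k'_def k''_def
    by (auto intro!: derivative_eq_intros du[OF s]) algebra
  moreover have "k s * (k'' + (a + c * u s) * u s * k' s) - (k' s)\<^sup>2 - 4 * (k s) ^ 3 = 0"
    unfolding k_def k'_def k''_def by algebra
  then have "k s * (k'' + deriv f s / f s * k' s) - (k' s)\<^sup>2 - 4 * (k s) ^ 3 = 0"
    by (simp add: deriv_f[OF s] u_def)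
  ultimately show ?thesis using ricci_condition_X[of k k' k'' s \<theta>] s by blast
qed

end

subsection \<open>The maximal profile of negative curvature\<close>

locale negative_curvature_profile =
  fixes a c d :: real
  assumes a_neg: "a < 0" and c_pos: "c > 0"
begin

abbreviation \<Phi> where "\<Phi> \<equiv> profile_inverse a c d"

text \<open>The second inequality is \<open>f' > -1\<close> in terms of the value of \<open>f\<close>, as \<open>f' = a + c / f\<close>.\<close>

definition D where "D = {x. - c / a < x \<and> - c < (1 + a) * x}"

lemma D_bounds:
  assumes "x \<in> D"
  shows "0 < x" "a * x + c < 0" "- 1 < a + c / x" "a + c / x < 0"
proof -
  have "- c / a > 0" using a_neg c_pos by (simp add: divide_pos_neg)
  then show x: "0 < x" using assms by (simp add: D_def)
  show *: "a * x + c < 0" using assms a_neg by (simp add: D_def field_simps)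
  show "- 1 < a + c / x" "a + c / x < 0"
    using assms x * by (simp_all add: D_def field_simps)
qed

text \<open>If \<open>1 + a < 0\<close>, dividing the second inequality by \<open>1 + a\<close>
  gives an upper bound. Otherwise its right side is nonnegative for positive \<open>x\<close>, and
  it follows from \<open>c > 0\<close>.\<close>

lemma D_eq: "D = (if 1 + a < 0 then {- c / a <..< - c / (1 + a)} else {- c / a <..})"
proof (cases "1 + a < 0")
  case True
  then have *: "- c < (1 + a) * x \<longleftrightarrow> x < - c / (1 + a)" for x
    by (simp only: neg_less_divide_eq mult.commute)
  show ?thesis unfolding D_def * using True by (simp add: set_eq_iff)
next
  case False
  have "- c < (1 + a) * x" if "- c / a < x" for x
  proof -
    have "- c / a > 0" using a_neg c_pos by (simp add: divide_pos_neg)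
    then have "0 \<le> (1 + a) * x" using False that by simp
    then show ?thesis using c_pos by simp
  qed
  then show ?thesis using False by (auto simp: D_def)
qed

lemma open_D: "open D" and interval_D: "is_interval D"
  by (simp_all add: D_eq is_interval_1)

lemma \<Phi>_decreasing:
  assumes "x \<in> D" "y \<in> D" "x < y"
  shows "\<Phi> y < \<Phi> x"
  using assms D_bounds a_neg by (intro profile_inverse_decreasing) auto

lemma inj_\<Phi>: "inj_on \<Phi> D"
  using \<Phi>_decreasing by (metis inj_onI linorder_neq_iff)

lemma DERIV_\<Phi>: "x \<in> D \<Longrightarrow> (\<Phi> has_real_derivative x / (a * x + c)) (at x)"
  using a_neg D_bounds by (intro profile_inverse_deriv) auto

lemma continuous_\<Phi>: "continuous_on D \<Phi>"
  using DERIV_\<Phi> by (meson DERIV_isCont continuous_at_imp_continuous_on)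

text \<open>The logarithm makes \<open>\<Phi>\<close> blow up at \<open>- c / a\<close>. Asking for
  large values arbitrarily close to this endpoint gives both the unbounded domain and the limit of
  the inverse.\<close>

lemma \<Phi>_unbounded:
  assumes "e > 0"
  shows "\<exists>x\<in>D. \<Phi> x > M \<and> x < - c / a + e"
proof -
  \<comment> \<open>Here \<open>t = - a * x - c\<close> is the argument of the logarithm, so that
    \<open>x = - (t + c) / a\<close> and \<open>x\<close> tends to \<open>- c / a\<close> as
    \<open>t\<close> decreases to 0.\<close>
  have "filterlim (\<lambda>t. (- (t + c) - c * ln t - d) / a\<^sup>2) at_top (at_right 0)"
    using c_pos a_neg by real_asymp
  then have "\<forall>\<^sub>F t in at_right 0. (- (t + c) - c * ln t - d) / a\<^sup>2 > M"
    by (simp add: filterlim_at_top_dense)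
  moreover have "((\<lambda>t. - (t + c) / a) \<longlongrightarrow> - (0 + c) / a) (at_right 0)"
    using a_neg by (intro tendsto_intros) auto
  then have lim: "((\<lambda>t. - (t + c) / a) \<longlongrightarrow> - c / a) (at_right 0)" by simp
  from order_tendstoD(2)[OF this, of "- c / a + e"]
  have "\<forall>\<^sub>F t in at_right 0. - (t + c) / a < - c / a + e" using assms by simp
  \<comment> \<open>The second inequality of \<open>D\<close> is strict at the endpoint itself,
    since \<open>(1 + a) * (- c / a) = - c - c / a\<close> and \<open>- c / a > 0\<close>; hence it
    persists nearby.\<close>
  moreover have "- c < (1 + a) * (- c / a)"
    using a_neg c_pos by (simp add: field_simps)
  with order_tendstoD(1)[OF tendsto_mult[OF tendsto_const lim]]
  have "\<forall>\<^sub>F t in at_right 0. - c < (1 + a) * (- (t + c) / a)" by blast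
  moreover have "\<forall>\<^sub>F t in at_right 0. (0::real) < t" by (rule eventually_at_right_less)
  ultimately have "\<forall>\<^sub>F t in at_right 0. (- (t + c) - c * ln t - d) / a\<^sup>2 > M \<and>
      - (t + c) / a < - c / a + e \<and> - c < (1 + a) * (- (t + c) / a) \<and> 0 < t"
    by eventually_elim auto
  then obtain t where t: "(- (t + c) - c * ln t - d) / a\<^sup>2 > M"
      "- (t + c) / a < - c / a + e" "- c < (1 + a) * (- (t + c) / a)" "0 < t"
    using eventually_happens'[OF trivial_limit_at_right_real] by blast
  have "\<Phi> (- (t + c) / a) = (- (t + c) - c * ln t - d) / a\<^sup>2"
    using a_neg by (simp add: profile_inverse_def)
  moreover have "- c / a < - (t + c) / a"
    using t(4) a_neg by (intro divide_strict_right_mono_neg) auto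
  then have "- (t + c) / a \<in> D"
    using t(3) unfolding D_def by blast
  ultimately show ?thesis using t by (intro bexI[of _ "- (t + c) / a"]) auto
qed

section \<open>The inverse of \<open>\<Phi>\<close> on \<open>D\<close>, its domain and its
  limit\<close>

definition J where "J = \<Phi> ` D"

definition G where "G = the_inv_into D \<Phi>"

lemma open_J: "open J"
  unfolding J_def
  by (rule injective_into_1d_imp_open_map_UNIV[OF open_D continuous_\<Phi> inj_\<Phi> subset_refl])

lemma interval_J: "is_interval J"
  using connected_continuous_image[OF continuous_\<Phi>] interval_D
  by (simp add: J_def is_interval_connected_1)

lemma J_nonempty: "J \<noteq> {}"
  using \<Phi>_unbounded[of 1] by (auto simp: J_def)

lemma J_unbounded: "\<not> bdd_above J"
  unfolding J_def bdd_above_def using \<Phi>_unbounded[of 1] by (auto simp: not_le)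

lemma G_in_D: "s \<in> J \<Longrightarrow> G s \<in> D" and \<Phi>_G: "s \<in> J \<Longrightarrow> \<Phi> (G s) = s"
  and G_\<Phi>: "x \<in> D \<Longrightarrow> G (\<Phi> x) = x"
  by (auto simp: J_def G_def the_inv_into_f_f inj_\<Phi>)

lemma J_upward:
  assumes "s \<in> J" "s \<le> t"
  shows "t \<in> J"
proof -
  obtain r where "r \<in> J" "t < r" using \<Phi>_unbounded[of 1 t] by (auto simp: J_def)
  then show ?thesis using assms interval_J by (meson less_imp_le mem_is_interval_1_I)
qed

text \<open>As \<open>\<Phi>\<close> is decreasing, \<open>s \<ge> \<Phi> x\<close> forces
  \<open>G s \<le> x\<close>, and \<open>x\<close> can be taken close to \<open>- c / a\<close>. The
  form with \<open>F\<close> serves extensions that are known only on \<open>J\<close>.\<close>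

lemma G_tendsto:
  assumes "\<And>s. s \<in> J \<Longrightarrow> F s = G s"
  shows "(F \<longlongrightarrow> - c / a) at_top"
proof (rule tendstoI)
  fix e :: real assume "e > 0"
  then obtain x where x: "x \<in> D" "x < - c / a + e" using \<Phi>_unbounded[of e 0] by blast
  show "\<forall>\<^sub>F s in at_top. dist (F s) (- c / a) < e"
    using eventually_ge_at_top[of "\<Phi> x"]
  proof eventually_elim
    case (elim s)
    then have s: "s \<in> J" using J_upward x(1) by (auto simp: J_def)
    have "G s \<le> x"
      using \<Phi>_decreasing[OF x(1) G_in_D[OF s]] \<Phi>_G[OF s] elim by force
    then show ?case
      using G_in_D[OF s] x(2) assms[OF s] by (auto simp: D_def dist_real_def)
  qed
qed

lemma DERIV_G:
  assumes "s \<in> J"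
  shows "(G has_real_derivative a + c / G s) (at s)"
proof -
  define x where "x = G s"
  have x: "x \<in> D" and s: "s = \<Phi> x" using assms by (auto simp: x_def G_in_D \<Phi>_G)
  have "a + c / x = (a * x + c) / x"
    using D_bounds(1)[OF x] by (simp add: add_divide_distrib)
  \<comment> \<open>The inverse function theorem takes derivatives as linear maps: multiplication by
    \<open>a + c / x\<close> must invert multiplication by \<open>x / (a * x + c)\<close>.\<close>
  then have "(\<lambda>t. x / (a * x + c) * t) \<circ> (\<lambda>t. (a + c / x) * t) = id"
    using D_bounds(1,2)[OF x] by (simp add: fun_eq_iff)
  then have "(G has_derivative (\<lambda>t. (a + c / x) * t)) (at (\<Phi> x))"
    using has_derivative_inverse_strong[OF open_D x continuous_\<Phi> G_\<Phi>
        DERIV_\<Phi>[OF x, unfolded has_field_derivative_def]] by blast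
  then show ?thesis by (simp add: s G_\<Phi>[OF x] has_field_derivative_def)
qed

text \<open>The height function \<open>g\<close> of the maximal profile is an antiderivative of \<open>w\<close>.\<close>

definition w where "w s = sqrt (1 - (a + c / G s)\<^sup>2)"

text \<open>The strict bounds \<open>-1 < a + c / G s < 0\<close> keep the radicand away from 0,
  where the square root is not differentiable.\<close>

lemma w_pos:
  assumes "s \<in> J"
  shows "0 < w s" "(w s)\<^sup>2 = 1 - (a + c / G s)\<^sup>2"
proof -
  have "\<bar>a + c / G s\<bar> < 1" using D_bounds[OF G_in_D[OF assms]] by simp
  then have "(a + c / G s)\<^sup>2 < 1" by (simp add: abs_square_less_1)
  then show "0 < w s" "(w s)\<^sup>2 = 1 - (a + c / G s)\<^sup>2" by (simp_all add: w_def)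
qed

lemma DERIV_inverse_G:
  assumes "s \<in> J"
  shows "((\<lambda>t. 1 / G t) has_real_derivative - (1 / G s)\<^sup>2 * (a + c * (1 / G s))) (at s)"
  using D_bounds(1)[OF G_in_D[OF assms]]
  by (auto intro!: derivative_eq_intros DERIV_G[OF assms]
      simp: power2_eq_square diff_divide_distrib add_divide_distrib)

lemma DERIV_w:
  assumes "s \<in> J"
  shows "(w has_real_derivative (a + c * (1 / G s))\<^sup>2 * c * (1 / G s)\<^sup>2 / w s) (at s)"
proof -
  let ?u = "\<lambda>t. 1 / G t"
  have "((\<lambda>t. 1 - (a + c * ?u t)\<^sup>2) has_real_derivative
      2 * ((a + c * ?u s)\<^sup>2 * c * (?u s)\<^sup>2)) (at s)"
    by (rule derivative_eq_intros DERIV_inverse_G[OF assms] refl)+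
      (simp add: power2_eq_square)
  from DERIV_chain2[OF DERIV_real_sqrt this] show ?thesis
    using w_pos[OF assms] unfolding w_def by (simp add: field_simps)
qed

text \<open>With \<open>u = 1 / G\<close> and \<open>v = 1 / w\<close>, the functions \<open>p(u) v\<^sup>n\<close> with a polynomial \<open>p\<close> are closed under
  differentiation, because \<open>v\<^sup>2 (1 - (a + c u)\<^sup>2) = 1\<close>.\<close>

lemma smooth_of_derivative_in_u_v:
  assumes h: "\<And>s. s \<in> J \<Longrightarrow> (h has_real_derivative poly p (1 / G s) * (1 / w s) ^ n) (at s)"
  shows "smooth_on J h"
proof -
  define R where "R p n s = poly p (1 / G s) * (1 / w s) ^ n" for p and n :: nat and s
  \<comment> \<open>\<open>h\<close> is adjoined separately: only its derivative has the form
    \<open>R p n\<close>, as is the case for the height function.\<close>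
  define C where "C = insert h (range (case_prod R))"
  \<comment> \<open>With \<open>u = 1 / G\<close> and \<open>v = 1 / w\<close>, these polynomials in
    \<open>u\<close> satisfy \<open>u' = P1\<close>, \<open>w\<^sup>2 = P2\<close> and
    \<open>v' = P3 * v ^ 3\<close>.\<close>
  define P1 P2 P3 where "P1 = [:0, 0, - a, - c:]" and "P2 = 1 - [:a, c:]\<^sup>2"
    and "P3 = [:0, 0, - c:] * [:a, c:]\<^sup>2"
  \<comment> \<open>Differentiating \<open>v ^ n\<close> raises the exponent by 2; the other summand
    is brought to the same exponent by the factor \<open>v\<^sup>2 * P2 = 1\<close>.\<close>
  have R: "(R p n has_real_derivative R (pderiv p * P1 * P2 + smult (of_nat n) (p * P3)) (n + 2) s) (at s)"
    if s: "s \<in> J" for p n s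
  proof -
    define u v where "u = 1 / G s" and "v = 1 / w s"
    have v: "v\<^sup>2 * poly P2 u = 1"
      using w_pos[OF s] by (simp add: v_def u_def P2_def field_simps)
    have P3: "poly P3 u = - ((a + c * u)\<^sup>2 * c * u\<^sup>2)"
      by (simp add: P3_def power2_eq_square algebra_simps)
    have "((\<lambda>t. 1 / w t) has_real_derivative poly P3 u * v ^ 3) (at s)"
      unfolding P3 using w_pos(1)[OF s] DERIV_w[OF s, folded u_def]
      by (auto intro!: derivative_eq_intros simp: v_def power2_eq_square power3_eq_cube)
    from DERIV_power[OF this, of n]
    have dv: "((\<lambda>t. (1 / w t) ^ n) has_real_derivative of_nat n * poly P3 u * v ^ (n + 2)) (at s)"
      by (cases n) (simp_all add: v_def power3_eq_cube power2_eq_square mult_ac)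
    have "poly P1 u = - u\<^sup>2 * (a + c * u)"
      by (simp add: P1_def power2_eq_square algebra_simps)
    then have "((\<lambda>t. 1 / G t) has_real_derivative poly P1 u) (at s)"
      using DERIV_inverse_G[OF s, folded u_def] by simp
    from DERIV_chain2[OF poly_DERIV this[unfolded u_def]]
    have "((\<lambda>t. poly p (1 / G t)) has_real_derivative poly (pderiv p) u * poly P1 u) (at s)"
      by (simp add: u_def)
    from DERIV_mult[OF this dv]
    have "(R p n has_real_derivative
        poly (pderiv p) u * poly P1 u * v ^ n + of_nat n * poly P3 u * v ^ (n + 2) * poly p u) (at s)"
      unfolding R_def by (simp add: u_def v_def)
    moreover have "R (pderiv p * P1 * P2 + smult (of_nat n) (p * P3)) (n + 2) s =
        poly (pderiv p) u * poly P1 u * v ^ n * (v\<^sup>2 * poly P2 u)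
          + of_nat n * poly P3 u * v ^ (n + 2) * poly p u"
      unfolding R_def u_def[symmetric] v_def[symmetric]
      by (simp add: algebra_simps power2_eq_square)
    ultimately show ?thesis by (simp only: v mult_1_right)
  qed
  show ?thesis
  proof (rule smooth_on_derivative_closed[OF open_J, of h C])
    show "h \<in> C" by (simp add: C_def)
    fix k assume "k \<in> C"
    then consider "k = h" | q m where "k = R q m" by (auto simp: C_def)
    then show "\<exists>k'\<in>C. \<forall>x\<in>J. (k has_real_derivative k' x) (at x)"
    proof cases
      case 1
      have "R p n \<in> C" by (auto simp: C_def intro: rev_image_eqI[of "(p, n)"])
      moreover have "\<forall>x\<in>J. (k has_real_derivative R p n x) (at x)"
        using h unfolding R_def 1 by blast
      ultimately show ?thesis by blast
    next
      case 2
      have "R (pderiv q * P1 * P2 + smult (of_nat m) (q * P3)) (m + 2) \<in> C"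
        unfolding C_def by (metis UNIV_I case_prod_conv image_eqI insertI2)
      then show ?thesis using R 2 by blast
    qed
  qed
qed

lemma implicit_G: "implicit_profile a c d J G"
  using a_neg D_bounds G_in_D by (auto simp: implicit_profile_iff \<Phi>_G)

text \<open>Take an antiderivative \<open>W\<close> of \<open>w\<close> as height. The speed is then
  1 by the choice of \<open>w\<close>, and the Ricci condition follows from the implicit
  equation.\<close>

lemma admissible_G: "implicit_Ricci_profile a c d J G"
proof -
  have "isCont w s" if "s \<in> J" for s using DERIV_w[OF that] by (rule DERIV_isCont)
  then have "continuous_on J w" by (simp add: continuous_at_imp_continuous_on)
  then obtain W where W: "\<And>s. s \<in> J \<Longrightarrow> (W has_real_derivative w s) (at s)"
    using antiderivative_on_open_interval[OF open_J interval_J] by blast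
  have "smooth_on J G"
    by (rule smooth_of_derivative_in_u_v[of _ "[:a, c:]" 0])
      (use DERIV_G in \<open>simp add: divide_inverse mult.commute\<close>)
  \<comment> \<open>Writing \<open>w\<close> as \<open>w\<^sup>2 / w\<close> puts \<open>W'\<close>
    into the form required for smoothness, with exponent 1.\<close>
  moreover have "w s = poly (1 - [:a, c:]\<^sup>2) (1 / G s) * (1 / w s) ^ 1" if "s \<in> J" for s
  proof -
    have "poly (1 - [:a, c:]\<^sup>2) (1 / G s) = (w s)\<^sup>2"
      by (simp add: w_pos(2)[OF that])
    then show ?thesis using w_pos(1)[OF that] by (simp add: power2_eq_square)
  qed
  then have "smooth_on J W"
    using W by (intro smooth_of_derivative_in_u_v[of W "1 - [:a, c:]\<^sup>2" 1]) metis
  moreover have "G s > 0 \<and> (deriv G s)\<^sup>2 + (deriv W s)\<^sup>2 = 1 \<and> deriv W s \<ge> 0" if "s \<in> J" for s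
    using D_bounds(1)[OF G_in_D[OF that]] w_pos[OF that]
      DERIV_imp_deriv[OF DERIV_G[OF that]] DERIV_imp_deriv[OF W[OF that]]
    by simp
  ultimately have surf: "rotational_surface J G W"
    by (simp add: rotational_surface_def open_J interval_J J_nonempty)
  interpret implicit_rotational J G W a c d
    using surf a_neg c_pos implicit_G by unfold_locales auto
  show ?thesis
    using implicit_G surf ricci_condition_implicit
    by (auto simp: implicit_Ricci_profile_def rotational_Ricci_surface_def)
qed

text \<open>\<open>af_c_neg\<close> and \<open>f_lower\<close> place \<open>f s\<close> in
  \<open>D\<close>; then \<open>s = \<Phi> (f s)\<close> lies in \<open>J\<close> and
  \<open>G\<close> recovers \<open>f s\<close>. Thus every profile is a restriction of
  \<open>G\<close>.\<close>

lemma implicit_rotational_range: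
  assumes "implicit_rotational I f g a c d" "s \<in> I"
  shows "f s \<in> D" "s \<in> J" "G s = f s"
proof -
  interpret implicit_rotational I f g a c d by fact
  show *: "f s \<in> D"
    using af_c_neg[OF assms(2)] f_lower[OF assms(2)] a_neg by (simp add: D_def field_simps)
  show "s \<in> J" "G s = f s"
    using * profile_inverse_f[OF assms(2)] G_\<Phi>[OF *] by (auto simp: J_def intro: rev_image_eqI)
qed

lemma admissible_subset:
  assumes "implicit_Ricci_profile a c d I f"
  shows "I \<subseteq> J" "s \<in> I \<Longrightarrow> G s = f s"
proof -
  obtain g where "implicit_rotational I f g a c d"
    using assms a_neg c_pos
    by (auto simp: implicit_Ricci_profile_def rotational_Ricci_surface_def
        implicit_rotational_def implicit_rotational_axioms_def rotational_def)
  then show "I \<subseteq> J" "s \<in> I \<Longrightarrow> G s = f s" using implicit_rotational_range by blast+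
qed

lemma asymptotic:
  assumes f: "implicit_Ricci_profile a c d I f"
  shows "asymptotic_to (implicit_Ricci_profile a c d) I f (- c / a)"
  unfolding asymptotic_to_def
proof (intro conjI exI allI impI)
  show "maximal_extension (implicit_Ricci_profile a c d) I f J G"
    using admissible_subset[OF f] admissible_G
    by (auto simp: maximal_extension_def dest!: admissible_subset(1))
next
  fix J' F assume F: "maximal_extension (implicit_Ricci_profile a c d) I f J' F"
  then have "implicit_Ricci_profile a c d J' F" by (simp add: maximal_extension_def)
  note sub = admissible_subset[OF this]
  have "\<And>J'' F''. J' \<subseteq> J'' \<Longrightarrow> (\<And>s. s \<in> J' \<Longrightarrow> F'' s = F s) \<Longrightarrow>
      implicit_Ricci_profile a c d J'' F'' \<Longrightarrow> J'' = J'"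
    using F unfolding maximal_extension_def by blast
  \<comment> \<open>\<open>G\<close> on \<open>J\<close> is itself an admissible extension of
    \<open>F\<close>, so maximality of \<open>F\<close> forces the domains to agree.\<close>
  from this[OF sub admissible_G] have "J = J'" .
  then show "\<not> bdd_above J'" "(F \<longlongrightarrow> - c / a) at_top"
    using J_unbounded G_tendsto sub(2) by auto
qed

end

section \<open>The classification, by the sign of \<open>c\<close>\<close>

theorem theorem3p6:
  fixes f g :: "real \<Rightarrow> real" and I :: "real set" and a c d s0 :: real
    and K :: "real \<Rightarrow> real \<Rightarrow> real"
  assumes "rotational_Ricci_surface I f g"
    and "a \<noteq> 0" and "c \<noteq> 0"
    and "implicit_profile a c d I f"
    and K: "K = gaussian_curvature (rotational_patch f g)"
    and "\<forall>s\<in>I. \<forall>\<theta>. K s \<theta> \<noteq> 0"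
    and s0: "s0 = - c / (a * (1 + a)) - c / a\<^sup>2 * ln (- c / (1 + a)) - d / a\<^sup>2"
  shows "strict_antimono_on I f \<and> diffeomorphism_onto_image I f \<and>
    ((\<forall>s\<in>I. \<forall>\<theta>. K s \<theta> < 0) \<and> a < 0 \<and> c > 0 \<and>
       asymptotic_to (implicit_Ricci_profile a c d) I f (- c / a) \<and>
       ((-1 \<le> a \<and> a < 0 \<and> I \<subseteq> UNIV \<and> f ` I \<subseteq> {- c / a <..}) \<or>
        (a < -1 \<and> I \<subseteq> {s0 <..} \<and> f ` I \<subseteq> {- c / a <..< - c / (1 + a)}))
     \<or>
     (\<forall>s\<in>I. \<forall>\<theta>. K s \<theta> > 0) \<and> a \<in> {-1 <..< 0} \<union> {0 <..} \<and> c < 0 \<and>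
       ((a > 0 \<and> I \<subseteq> {..< s0} \<and> f ` I \<subseteq> {- c / (1 + a) <..< - c / a}) \<or>
        (-1 < a \<and> a < 0 \<and> I \<subseteq> {..< s0} \<and> f ` I \<subseteq> {- c / (1 + a) <..})))"
proof -
  have surf: "rotational_surface I f g" using assms(1) by (simp add: rotational_Ricci_surface_def)
  interpret implicit_rotational I f g a c d
    using surf assms(2-4) by unfold_locales
  obtain p where p: "p \<in> I" using surf by (auto simp: rotational_surface_def)
  \<comment> \<open>\<open>x0\<close> is the value at which \<open>a + c / x = -1\<close>, and
    \<open>s0\<close> is its image under \<open>profile_inverse\<close>. The identity
    \<open>a * x0 + c = - x0\<close> makes \<open>x0\<close> the argument of the logarithm.\<close>
  define x0 where "x0 = - c / (1 + a)"
  have x0: "a * x0 + c = - x0" "profile_inverse a c d x0 = s0" if "1 + a \<noteq> 0"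
  proof -
    show *: "a * x0 + c = - x0"
      using that by (simp add: x0_def field_simps)
    then have "- a * x0 - c = x0" by simp
    then have "profile_inverse a c d x0 = (a * x0 - c * ln x0 - d) / a\<^sup>2"
      unfolding profile_inverse_def by simp
    also have "\<dots> = a * x0 / a\<^sup>2 - c / a\<^sup>2 * ln x0 - d / a\<^sup>2"
      by (simp add: diff_divide_distrib)
    also have "a * x0 / a\<^sup>2 = - c / (a * (1 + a))"
      using a_nonzero that by (simp add: x0_def power2_eq_square)
    finally show "profile_inverse a c d x0 = s0" by (simp add: s0 x0_def)
  qed
  have K_eq: "K s \<theta> = c * ((a + c / f s) / f s ^ 3)" if "s \<in> I" for s \<theta>
    using gaussian_curvature_implicit[OF that] K by simp
  have neg: "(a + c / f s) / f s ^ 3 < 0" if "s \<in> I" for s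
    using deriv_f_neg[OF that] f_pos[OF that] by (simp add: divide_neg_pos)
  show ?thesis
  proof (cases "c > 0")
    case True
    have "a * f p < 0" using af_c_neg[OF p] True by simp
    then have a: "a < 0" using f_pos[OF p] by (simp add: mult_less_0_iff)
    interpret negative_curvature_profile a c d using a True by unfold_locales
    have "implicit_Ricci_profile a c d I f"
      using assms(1,4) by (auto simp: implicit_Ricci_profile_def)
    note as = asymptotic[OF this]
    have K_neg: "\<forall>s\<in>I. \<forall>\<theta>. K s \<theta> < 0"
      using K_eq neg True by (metis mult_pos_neg)
    have D: "f s \<in> D" if "s \<in> I" for s
      using implicit_rotational_range(1)[OF implicit_rotational_axioms that] .
    show ?thesis
    proof (cases "- 1 \<le> a")
      case True
      then show ?thesis using f_decreasing f_diffeomorphism K_neg a c_pos as D by (auto simp: D_def)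
    next
      case False
      then have "x0 > 0" using c_pos by (auto simp: x0_def divide_pos_neg)
      have lt: "f s < x0" if "s \<in> I" for s
        using D[OF that] False by (auto simp: D_eq x0_def)
      \<comment> \<open>The decreasing function \<open>profile_inverse\<close> turns
        \<open>f s < x0\<close> into \<open>s0 < s\<close>.\<close>
      have "s0 < s" if s: "s \<in> I" for s
        using profile_inverse_decreasing[OF a_nonzero f_pos[OF s] lt[OF s] af_c_neg[OF s], of d]
          x0 False \<open>x0 > 0\<close> profile_inverse_f[OF s] by simp
      then show ?thesis using f_decreasing f_diffeomorphism K_neg a c_pos as D False by (auto simp: D_eq)
    qed
  next
    case False
    then have c: "c < 0" using c_nonzero by simp
    have K_pos: "\<forall>s\<in>I. \<forall>\<theta>. K s \<theta> > 0"
      using K_eq neg c by (metis mult_neg_neg)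
    \<comment> \<open>With \<open>c < 0\<close> the inequality \<open>f_lower\<close> excludes
      \<open>a \<le> -1\<close>.\<close>
    have "0 < (1 + a) * f p" using f_lower[OF p] c by simp
    then have a: "1 + a > 0" using f_pos[OF p] by (simp add: zero_less_mult_iff)
    have "x0 > 0" using a c by (simp add: x0_def divide_neg_pos)
    have gt: "x0 < f s" if "s \<in> I" for s
      using f_lower[OF that] a by (simp only: x0_def pos_divide_less_eq mult.commute)
    have "s < s0" if s: "s \<in> I" for s
      using profile_inverse_decreasing[OF a_nonzero \<open>x0 > 0\<close> gt[OF s], of c d]
        x0 a \<open>x0 > 0\<close> profile_inverse_f[OF s] af_c_neg[OF s] by simp
    moreover have "f s < - c / a" if "s \<in> I" "a > 0" for s
      using af_c_neg[OF that(1)] that(2) by (simp add: field_simps)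
    ultimately show ?thesis
      using f_decreasing f_diffeomorphism K_pos a c a_nonzero gt by (cases "a > 0") (auto simp: x0_def)
  qed
qed

end
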